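(* Automorphic equivalence of graphs preserves neither the property of being a tree nor connectedness. That is: (1) there exist finite automorphically equivalent graphs $G_1=(V_1,E_1)$ and $G_2=(V_2,E_2)$ such that $G_1$ is a tree and $G_2$ is not a tree; (2) there exist finite automorphically equivalent graphs $G_1=(V_1,E_1)$ and $G_2=(V_2,E_2)$ such that $G_1$ is connected and $G_2$ is not connected.
   Context: A graph is a pair $G=(V,E)$ with vertex set $V$ and edge set $E$; it is regarded as a model $(V,\varphi,E)$ whose domain $V$ carries no operations and whose only relation symbol $\varphi$ is binary, interpreted as the edge relation $E\subseteq V\times V$ (for an undirected graph, $E$ is symmetric and irreflexive). In this statement graphs are undirected. A tree is a connected graph with no cycles. The group $\mathrm{Aut}(G)$ consists of all permutations of $V$ preserving edges. Two graphs $G_1=(V_1,E_1)$ and $G_2=(V_2,E_2)$ are automorphically equivalent if there is a bijection $\mu:V_1\to V_2$ such that $\mathrm{Aut}(G_2)=\mu\,\mathrm{Aut}(G_1)\,\mu^{-1}$. *)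

theory Defs
  imports "Graph_Theory.Graph_Theory" "HOL-Combinatorics.Permutations"
begin

text \<open>
  A finite undirected graph \<open>(V, E)\<close> is a \<open>pair_graph\<close>, with \<open>V = pverts G\<close> finite and
  \<open>E = parcs G \<subseteq> V \<times> V\<close> symmetric and irreflexive. The library's \<open>forest\<close> and \<open>tree\<close> are
  not usable for such graphs: an edge \<open>{a, b}\<close> already yields the directed cycle
  \<open>a, b, a\<close>. A cycle of an undirected graph is a directed cycle with at least three arcs.
\<close>

definition undirected_cycle :: "'a pair_pre_digraph \<Rightarrow> ('a \<times> 'a) awalk \<Rightarrow> bool" where
  "undirected_cycle G p \<longleftrightarrow> pre_digraph.cycle (with_proj G) p \<and> 3 \<le> length p"

definition undirected_tree :: "'a pair_pre_digraph \<Rightarrow> bool" where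
  "undirected_tree G \<longleftrightarrow>
     Digraph_Component.connected (with_proj G) \<and> \<not> (\<exists>p. undirected_cycle G p)"

text \<open>A permutation of \<open>V\<close> is represented by its extension by the identity outside \<open>V\<close>.\<close>

definition Aut :: "'a pair_pre_digraph \<Rightarrow> ('a \<Rightarrow> 'a) set" where
  "Aut G = {f. f permutes pverts G \<and>
     (\<forall>u\<in>pverts G. \<forall>v\<in>pverts G. (u, v) \<in> parcs G \<longleftrightarrow> (f u, f v) \<in> parcs G)}"

text \<open>
  \<open>map_permutation V \<mu> f\<close> is the conjugate \<open>\<mu> f \<mu>\<^sup>-\<^sup>1\<close> on \<open>\<mu> ` V\<close>, extended by the identity.
\<close>

definition automorphically_equivalent ::
    "'a pair_pre_digraph \<Rightarrow> 'b pair_pre_digraph \<Rightarrow> bool" where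
  "automorphically_equivalent G1 G2 \<longleftrightarrow>
     (\<exists>\<mu>. bij_betw \<mu> (pverts G1) (pverts G2) \<and>
          Aut G2 = map_permutation (pverts G1) \<mu> ` Aut G1)"

end

theory Submission
  imports Defs
begin

text \<open>Every permutation of \<open>V\<close> preserves both the relation "distinct" and the
  empty relation, so the complete and the edgeless graph on \<open>V\<close> have the full symmetric
  group as automorphism group (\<open>Aut_complete_graph\<close>, \<open>Aut_edgeless_graph\<close>)
  and are equivalent via the identity. For two vertices, the first is a single edge: connected, and
  too small for a cycle with three arcs (\<open>cycle_length_le_card_verts\<close>). The second is
  disconnected, hence no tree. This one pair witnesses both claims.\<close>

text \<open>
  A graph and its complement have the same automorphisms. The complete graph on two vertices is
  a tree, whereas its complement is disconnected.
\<close>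

definition complete_graph :: "'a set \<Rightarrow> 'a pair_pre_digraph" where
  "complete_graph V = \<lparr>pverts = V, parcs = {(u, v). u \<in> V \<and> v \<in> V \<and> u \<noteq> v}\<rparr>"

definition edgeless_graph :: "'a set \<Rightarrow> 'a pair_pre_digraph" where
  "edgeless_graph V = \<lparr>pverts = V, parcs = {}\<rparr>"

lemma complete_graph_simps [simp]:
  "pverts (complete_graph V) = V"
  "(u, v) \<in> parcs (complete_graph V) \<longleftrightarrow> u \<in> V \<and> v \<in> V \<and> u \<noteq> v"
  by (simp_all add: complete_graph_def)

lemma edgeless_graph_simps [simp]:
  "pverts (edgeless_graph V) = V"
  "parcs (edgeless_graph V) = {}"
  by (simp_all add: edgeless_graph_def)

lemma pair_graph_complete_graph:
  assumes "finite V"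
  shows "pair_graph (complete_graph V)"
proof
  have "parcs (complete_graph V) \<subseteq> V \<times> V"
    by auto
  then show "finite (parcs (complete_graph V))"
    using assms by (auto intro: finite_subset)
qed (use assms in \<open>auto simp: symmetric_def sym_def\<close>)

lemma pair_graph_edgeless_graph:
  assumes "finite V"
  shows "pair_graph (edgeless_graph V)"
  by unfold_locales (use assms in \<open>auto simp: symmetric_def sym_def\<close>)

lemma Aut_complete_graph: "Aut (complete_graph V) = {f. f permutes V}"
  by (auto simp: Aut_def permutes_in_image dest: permutes_inj injD)

lemma Aut_edgeless_graph: "Aut (edgeless_graph V) = {f. f permutes V}"
  by (auto simp: Aut_def)

lemma automorphically_equivalent_same_Aut:
  assumes "pverts G = pverts H" "Aut G = Aut H"
  shows "automorphically_equivalent G H"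
  unfolding automorphically_equivalent_def
proof (intro exI conjI)
  show "bij_betw id (pverts G) (pverts H)"
    using assms(1) by simp
  \<comment> \<open>Conjugation by the identity could change \<open>f\<close> only outside the
    vertex set, where \<open>f\<close> is already the identity.\<close>
  have "map_permutation (pverts G) id f = f" if "f \<in> Aut G" for f
    using that by (simp add: Aut_def)
  then show "Aut H = map_permutation (pverts G) id ` Aut G"
    using assms(2) by simp
qed

text \<open>Connectedness is strong connectedness of the symmetric closure; there, any two distinct
  vertices are joined by one arc.\<close>

lemma connected_complete_graph:
  assumes "V \<noteq> {}"
  shows "Digraph_Component.connected (with_proj (complete_graph V))"
  unfolding Digraph_Component.connected_def
proof (rule strongly_connectedI)
  let ?G = "mk_symmetric (with_proj (complete_graph V))"
  show "verts ?G \<noteq> {}"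
    using assms by (simp add: mk_symmetric_def)
  fix u v assume uv: "u \<in> verts ?G" "v \<in> verts ?G"
  show "u \<rightarrow>\<^sup>*\<^bsub>?G\<^esub> v"
  proof (cases "u = v")
    case True
    then show ?thesis
      using uv by (simp add: reachable_def)
  next
    case False
    then have "(u, v) \<in> arcs_ends ?G"
      using uv by (auto simp: mk_symmetric_def arcs_ends_conv)
    then show ?thesis
      using uv unfolding reachable_def by (auto intro: rtrancl_on_into_rtrancl_on)
  qed
qed

text \<open>The symmetric closure of no arcs has no arcs, so each vertex reaches only
  itself.\<close>

lemma not_connected_edgeless_graph:
  assumes "u \<in> V" "v \<in> V" "u \<noteq> v"
  shows "\<not> Digraph_Component.connected (with_proj (edgeless_graph V))"
proof
  let ?G = "mk_symmetric (with_proj (edgeless_graph V))"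
  assume "Digraph_Component.connected (with_proj (edgeless_graph V))"
  then have "(u, v) \<in> rtrancl_on V (arcs_ends ?G)"
    using assms
    by (auto simp: Digraph_Component.connected_def strongly_connected_def reachable_def
        mk_symmetric_def)
  moreover have "arcs_ends ?G = {}"
    by (simp add: mk_symmetric_def arcs_ends_conv)
  ultimately show False
    using assms(3) by (auto elim: rtrancl_on.cases)
qed

text \<open>A cycle enters a different vertex with each of its arcs.\<close>

lemma (in fin_digraph) cycle_length_le_card_verts:
  assumes "cycle p"
  shows "length p \<le> card (verts G)"
proof -
  obtain u where u: "awalk u p u" "distinct (tl (awalk_verts u p))" "p \<noteq> []"
    using assms by (auto simp: cycle_def)
  \<comment> \<open>\<open>awalk_verts\<close> lists one vertex more than there are arcs;
    \<open>tl\<close> drops the start, which recurs at the end.\<close>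
  have "length p = card (set (tl (awalk_verts u p)))"
    using u(2) by (simp add: distinct_card length_awalk_verts)
  moreover have "set (tl (awalk_verts u p)) \<subseteq> verts G"
    using u(1) by (meson awalkE' awalk_verts_in_verts awalk_hd_in_verts list.set_sel(2) subsetI
        awalk_verts_non_Nil)
  ultimately show ?thesis
    by (simp add: card_mono)
qed

text \<open>Directed cycles have at most two arcs here, so going back and forth along the edge is
  not counted as an undirected cycle.\<close>

lemma undirected_tree_complete_graph:
  assumes "card V = 2"
  shows "undirected_tree (complete_graph V)"
proof -
  have V: "finite V" "V \<noteq> {}"
    using assms by (auto intro: card_ge_0_finite)
  interpret pair_graph "complete_graph V"
    by (rule pair_graph_complete_graph [OF V(1)])
  have "length p \<le> 2" if "cycle p" for p
    using cycle_length_le_card_verts [OF that] assms by simp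
  then show ?thesis
    using connected_complete_graph [OF V(2)]
    by (fastforce simp: undirected_tree_def undirected_cycle_def)
qed

theorem mainTheorem4:
  shows "(\<exists>(G1 :: nat pair_pre_digraph) (G2 :: nat pair_pre_digraph).
            pair_graph G1 \<and> pair_graph G2 \<and> automorphically_equivalent G1 G2 \<and>
            undirected_tree G1 \<and> \<not> undirected_tree G2) \<and>
         (\<exists>(G1 :: nat pair_pre_digraph) (G2 :: nat pair_pre_digraph).
            pair_graph G1 \<and> pair_graph G2 \<and> automorphically_equivalent G1 G2 \<and>
            Digraph_Component.connected (with_proj G1) \<and>
            \<not> Digraph_Component.connected (with_proj G2))"
proof -
  let ?V = "{0, 1 :: nat}"
  have "pair_graph (complete_graph ?V)" "pair_graph (edgeless_graph ?V)"
    by (simp_all add: pair_graph_complete_graph pair_graph_edgeless_graph)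
  moreover have "automorphically_equivalent (complete_graph ?V) (edgeless_graph ?V)"
    by (simp add: automorphically_equivalent_same_Aut Aut_complete_graph Aut_edgeless_graph)
  moreover have "undirected_tree (complete_graph ?V)"
    by (simp add: undirected_tree_complete_graph)
  moreover have "\<not> Digraph_Component.connected (with_proj (edgeless_graph ?V))"
    by (rule not_connected_edgeless_graph [of 0 _ 1]) simp_all
  \<comment> \<open>A tree is connected by definition, so disconnectedness of the edgeless graph
    settles both conjuncts.\<close>
  ultimately show ?thesis
    unfolding undirected_tree_def by blast
qed

end
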